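(* Let $D_1, D_2$ be two unique factorization domains, and let $n_1 \in D_1$ and $n_2 \in D_2$ be non-zero and not units. Let $n_1 = \prod_{i=1}^{A} p_i^{s_i}$ and $n_2 = \prod_{i=1}^{B} q_i^{t_i}$ be factorizations of $n_1, n_2$ into products of irreducibles. If $A = B$ and each $s_i = t_i$, then $\Gamma_C(D_1/\langle n_1 \rangle) \cong \Gamma_C(D_2/\langle n_2 \rangle)$ (isomorphism of graphs).
   Context: For a commutative ring $R$, $Z(R)$ denotes the set of zero-divisors: $r \in Z(R)$ if and only if there is $s \in R$, $s \neq 0$, with $rs = 0$. For $r \in R$, $\mathrm{ann}(r) = \{x \in R : rx = 0\}$. Write $r \sim s$ if $\mathrm{ann}(r) = \mathrm{ann}(s)$, and let $[r]$ denote the equivalence class of $r$. The compressed zero-divisor graph $\Gamma_C(R)$ is the simple (loopless, undirected) graph with vertex set $\{[r] : r \in Z(R),\ r \neq 0\}$, in which two distinct classes $[r], [s]$ are adjacent if and only if $xy = 0$ for all $x \in [r]$, $y \in [s]$ (equivalently, $rs = 0$). $\langle n \rangle$ denotes the principal ideal generated by $n$.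
   Formalization: The irreducibles p_i are assumed pairwise non-associate, likewise the q_i, and all exponents are positive; without non-associateness the claim fails, e.g. 4 = 2·2 and 6 = 2·3 in the integers. *)

theory Defs
  imports
    "HOL-Algebra.Ring_Divisibility"
    "HOL-Algebra.QuotRing"
    "Graph_Theory.Pair_Digraph"
    "Graph_Theory.Digraph_Isomorphism"
begin

definition zero_divisors :: "('a, 'm) ring_scheme \<Rightarrow> 'a set" where
  "zero_divisors R =
    {r \<in> carrier R. \<exists>s \<in> carrier R. s \<noteq> \<zero>\<^bsub>R\<^esub> \<and> r \<otimes>\<^bsub>R\<^esub> s = \<zero>\<^bsub>R\<^esub>}"

definition ann :: "('a, 'm) ring_scheme \<Rightarrow> 'a \<Rightarrow> 'a set" where
  "ann R r = {x \<in> carrier R. r \<otimes>\<^bsub>R\<^esub> x = \<zero>\<^bsub>R\<^esub>}"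

definition ann_class :: "('a, 'm) ring_scheme \<Rightarrow> 'a \<Rightarrow> 'a set" where
  "ann_class R r = {s \<in> carrier R. ann R s = ann R r}"

text \<open>
  Undirected simple graphs are encoded, as usual in \<open>Graph_Theory\<close>, by symmetric loopless
  sets of ordered pairs; lemma \<open>compressed_zero_divisor_graph_simple\<close> below checks this, and
  \<open>digraph_iso\<close> applied to such graphs is the usual notion of graph isomorphism. The locale
  \<open>graph\<close> is not used, as it would also demand finiteness.
\<close>

definition compressed_zero_divisor_graph ::
    "('a, 'm) ring_scheme \<Rightarrow> 'a set pair_pre_digraph" (\<open>\<Gamma>\<^sub>C\<close>) where
  "\<Gamma>\<^sub>C R =
    (let V = {ann_class R r | r. r \<in> zero_divisors R \<and> r \<noteq> \<zero>\<^bsub>R\<^esub>}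
     in \<lparr> pverts = V,
          parcs = {(U, W). U \<in> V \<and> W \<in> V \<and> U \<noteq> W \<and>
                     (\<forall>x \<in> U. \<forall>y \<in> W. x \<otimes>\<^bsub>R\<^esub> y = \<zero>\<^bsub>R\<^esub>)} \<rparr>)"

text \<open>
  \<open>n = p\<^sub>1 ^ s\<^sub>1 \<cdots> p\<^sub>k ^ s\<^sub>k\<close>, where the exponents are positive and, as usual when equal
  irreducibles are collected into powers, the \<open>p\<^sub>i\<close> are pairwise non-associated.
\<close>

definition irreducible_power_factorization ::
    "('a, 'm) ring_scheme \<Rightarrow> 'a \<Rightarrow> nat \<Rightarrow> (nat \<Rightarrow> 'a) \<Rightarrow> (nat \<Rightarrow> nat) \<Rightarrow> bool" where
  "irreducible_power_factorization D n k p s \<longleftrightarrow>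
    (\<forall>i \<in> {1..k}. p i \<in> carrier D \<and> ring_irreducible\<^bsub>D\<^esub> (p i) \<and> 0 < s i) \<and>
    (\<forall>i \<in> {1..k}. \<forall>j \<in> {1..k}. i \<noteq> j \<longrightarrow> \<not> p i \<sim>\<^bsub>D\<^esub> p j) \<and>
    n = (\<Otimes>\<^bsub>D\<^esub> i \<in> {1..k}. p i [^]\<^bsub>D\<^esub> s i)"

lemma compressed_zero_divisor_graph_simple:
  assumes "cring R"
  shows "pair_bidirected_digraph (\<Gamma>\<^sub>C R)"
proof -
  interpret cring R by fact
  have comm: "y \<otimes>\<^bsub>R\<^esub> x = \<zero>\<^bsub>R\<^esub>"
    if "x \<otimes>\<^bsub>R\<^esub> y = \<zero>\<^bsub>R\<^esub>" "x \<in> ann_class R r" "y \<in> ann_class R s" for x y r s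
    using that by (simp add: ann_class_def m_comm)
  have "sym (parcs (\<Gamma>\<^sub>C R))"
  proof (rule symI)
    fix U W assume "(U, W) \<in> parcs (\<Gamma>\<^sub>C R)"
    then show "(W, U) \<in> parcs (\<Gamma>\<^sub>C R)"
      unfolding compressed_zero_divisor_graph_def Let_def
      by clarsimp (blast intro: comm)
  qed
  then have "symmetric (with_proj (\<Gamma>\<^sub>C R))"
    by (simp add: symmetric_def)
  then show ?thesis
    by unfold_locales (auto simp: compressed_zero_divisor_graph_def Let_def)
qed

lemma ann_class_mult_zero_iff:
  assumes "cring R" "r \<in> carrier R" "s \<in> carrier R"
  shows "(\<forall>x \<in> ann_class R r. \<forall>y \<in> ann_class R s. x \<otimes>\<^bsub>R\<^esub> y = \<zero>\<^bsub>R\<^esub>)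
    \<longleftrightarrow> r \<otimes>\<^bsub>R\<^esub> s = \<zero>\<^bsub>R\<^esub>" (is "?L \<longleftrightarrow> ?R")
proof
  assume ?L
  then show ?R using assms by (auto simp: ann_class_def)
next
  interpret cring R by fact
  assume rs: ?R
  show ?L
  proof (intro ballI)
    fix x y assume x: "x \<in> ann_class R r" and y: "y \<in> ann_class R s"
    then have c: "x \<in> carrier R" "y \<in> carrier R" by (auto simp: ann_class_def)
    have "s \<in> ann R x" using x rs assms by (auto simp: ann_class_def ann_def)
    then have "x \<in> ann R s" using c assms by (auto simp: ann_def m_comm)
    then have "x \<in> ann R y" using y by (auto simp: ann_class_def)
    then show "x \<otimes>\<^bsub>R\<^esub> y = \<zero>\<^bsub>R\<^esub>" using c by (auto simp: ann_def m_comm)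
  qed
qed

lemma digraph_iso_pair_iff:
  assumes "pair_wf_digraph G" "pair_wf_digraph H"
  shows "digraph_iso (with_proj G) (with_proj H) \<longleftrightarrow>
    (\<exists>f. bij_betw f (pverts G) (pverts H) \<and>
      (\<forall>u \<in> pverts G. \<forall>v \<in> pverts G. (u, v) \<in> parcs G \<longleftrightarrow> (f u, f v) \<in> parcs H))"
    (is "?L \<longleftrightarrow> ?R")
proof
  interpret G: pair_wf_digraph G by fact
  assume ?L
  then obtain h where h: "pre_digraph.digraph_isomorphism (with_proj G) h"
    and H: "with_proj H = app_iso h (with_proj G)"
    unfolding digraph_iso_def by blast
  note h' = h[unfolded G.digraph_isomorphism_def, simplified]
  from H have V: "pverts H = iso_verts h ` pverts G" and A: "parcs H = iso_arcs h ` parcs G"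
    and T: "iso_tail h = fst" and Hd: "iso_head h = snd"
    by (auto simp: app_iso_def with_proj_def)
  have arc: "iso_arcs h e = (iso_verts h (fst e), iso_verts h (snd e))" if "e \<in> parcs G" for e
    using h' that by (simp add: T Hd prod_eq_iff)
  have inj: "inj_on (iso_verts h) (pverts G)" using h' by blast
  have "(u, v) \<in> parcs G \<longleftrightarrow> (iso_verts h u, iso_verts h v) \<in> parcs H"
    if uv: "u \<in> pverts G" "v \<in> pverts G" for u v
  proof
    assume "(u, v) \<in> parcs G"
    then show "(iso_verts h u, iso_verts h v) \<in> parcs H"
      unfolding A using arc[of "(u, v)"] by force
  next
    assume "(iso_verts h u, iso_verts h v) \<in> parcs H"
    then obtain a b where ab: "(a, b) \<in> parcs G"
      and e: "iso_verts h u = iso_verts h a" "iso_verts h v = iso_verts h b"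
      unfolding A using arc by fastforce
    then have "u = a" "v = b" using uv inj G.in_arcsD1[OF ab] G.in_arcsD2[OF ab]
      by (auto dest: inj_onD)
    then show "(u, v) \<in> parcs G" using ab by simp
  qed
  then show ?R using inj V by (intro exI[of _ "iso_verts h"]) (auto simp: bij_betw_def)
next
  interpret G: pair_wf_digraph G by fact
  interpret H: pair_wf_digraph H by fact
  assume ?R
  then obtain f where inj: "inj_on f (pverts G)" and V: "pverts H = f ` pverts G"
    and A: "\<And>u v. \<lbrakk>u \<in> pverts G; v \<in> pverts G\<rbrakk> \<Longrightarrow> (u, v) \<in> parcs G \<longleftrightarrow> (f u, f v) \<in> parcs H"
    by (auto simp: bij_betw_def)
  let ?h = "\<lparr> iso_verts = f, iso_arcs = map_prod f f, iso_head = snd, iso_tail = fst \<rparr>"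
  have "inj_on (map_prod f f) (parcs G)"
    by (rule inj_on_subset[OF map_prod_inj_on[OF inj inj]])
      (auto dest: G.in_arcsD1 G.in_arcsD2)
  then have 1: "pre_digraph.digraph_isomorphism (with_proj G) ?h"
    unfolding G.digraph_isomorphism_def using inj G.wf_digraph_axioms by simp
  have "parcs H = map_prod f f ` parcs G"
  proof (intro equalityI subsetI)
    fix e assume e: "e \<in> parcs H"
    obtain x y where xy: "e = (x, y)" by (cases e)
    with e have "x \<in> f ` pverts G" "y \<in> f ` pverts G"
      using H.in_arcsD1 H.in_arcsD2 V by auto
    then obtain u v where "u \<in> pverts G" "v \<in> pverts G" "x = f u" "y = f v" by blast
    moreover from this e xy have "(u, v) \<in> parcs G" by (simp only: A)
    ultimately show "e \<in> map_prod f f ` parcs G"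
      unfolding xy by (intro image_eqI[of _ _ "(u, v)"]) simp_all
  next
    fix e assume "e \<in> map_prod f f ` parcs G"
    then obtain u v where uv: "(u, v) \<in> parcs G" and e: "e = (f u, f v)" by auto
    show "e \<in> parcs H"
      using uv unfolding e by (simp only: A[OF G.in_arcsD1[OF uv] G.in_arcsD2[OF uv]])
  qed
  then have "with_proj H = app_iso ?h (with_proj G)"
    using V by (simp add: app_iso_def with_proj_def)
  with 1 show ?L unfolding digraph_iso_def by blast
qed

end

theory Submission
  imports Defs
begin

text \<open>
  The graph \<open>\<Gamma>\<^sub>C R\<close> depends only on which products vanish in \<open>R\<close>: if a relation \<open>T\<close> between two
  rings is total on both sides and \<open>x y = 0\<close> is equivalent to \<open>a b = 0\<close> whenever \<open>T x a\<close> and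
  \<open>T y b\<close>, then \<open>T\<close> respects annihilators and induces an isomorphism of the graphs. For
  \<open>n = \<Prod> p\<^sub>i ^ s\<^sub>i\<close>, divisibility of \<open>x y\<close> by \<open>n\<close> is determined by the pairs \<open>(i, j)\<close>, \<open>j \<le> s\<^sub>i\<close>, for
  which \<open>p\<^sub>i ^ j\<close> divides \<open>x\<close>, respectively \<open>y\<close>. Hence one relates the residue classes of \<open>x\<close> and
  \<open>a\<close> when these pairs agree for \<open>x, p\<close> and for \<open>a, q\<close>; totality is witnessed by the products
  \<open>\<Prod> q\<^sub>i ^ e\<^sub>i\<close> with \<open>e\<^sub>i \<le> s\<^sub>i\<close>.
\<close>

section \<open>Relations preserving vanishing products\<close>

text \<open>A relation instead of a map keeps the assumptions symmetric in the two rings. Only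
  vanishing of products has to match, because annihilators, zero divisors and adjacency are all
  expressed through it.\<close>

locale zero_product_correspondence =
  R: cring R + S: cring S
  for R :: "('a, 'm) ring_scheme" and S :: "('b, 'k) ring_scheme" +
  fixes T :: "'a \<Rightarrow> 'b \<Rightarrow> bool"
  assumes left_total: "x \<in> carrier R \<Longrightarrow> \<exists>a \<in> carrier S. T x a"
    and right_total: "a \<in> carrier S \<Longrightarrow> \<exists>x \<in> carrier R. T x a"
    and zero_product_iff:
      "\<lbrakk>T x a; T y b; x \<in> carrier R; y \<in> carrier R; a \<in> carrier S; b \<in> carrier S\<rbrakk>
        \<Longrightarrow> x \<otimes>\<^bsub>R\<^esub> y = \<zero>\<^bsub>R\<^esub> \<longleftrightarrow> a \<otimes>\<^bsub>S\<^esub> b = \<zero>\<^bsub>S\<^esub>"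
begin

text \<open>Swapping the rings turns the one-sided implications below into equivalences.\<close>

lemma converse: "zero_product_correspondence S R T\<inverse>\<inverse>"
  by unfold_locales (auto simp: left_total right_total zero_product_iff)

lemma zero_imp:
  assumes "T x a" "x \<in> carrier R" "a \<in> carrier S" "x = \<zero>\<^bsub>R\<^esub>"
  shows "a = \<zero>\<^bsub>S\<^esub>"
proof -
  obtain y where "y \<in> carrier R" "T y \<one>\<^bsub>S\<^esub>" using right_total by blast
  then show ?thesis using zero_product_iff[OF assms(1), of y "\<one>\<^bsub>S\<^esub>"] assms by simp
qed

text \<open>Every \<open>c\<close> in \<open>S\<close> has a partner \<open>z\<close> in
  \<open>R\<close>, and whether \<open>c\<close> annihilates \<open>a\<close> or \<open>b\<close>
  can be read off from whether \<open>z\<close> annihilates \<open>x\<close> or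
  \<open>y\<close>.\<close>

lemma ann_eq_imp:
  assumes "T x a" "T y b"
    and c: "x \<in> carrier R" "y \<in> carrier R" "a \<in> carrier S" "b \<in> carrier S"
    and eq: "ann R x = ann R y"
  shows "ann S a = ann S b"
proof -
  have "c \<in> ann S a \<longleftrightarrow> c \<in> ann S b" if c_in: "c \<in> carrier S" for c
  proof -
    obtain z where z: "z \<in> carrier R" "T z c" using right_total[OF c_in] by blast
    have "z \<in> ann R x \<longleftrightarrow> z \<in> ann R y" using eq by simp
    then show ?thesis
      using zero_product_iff[OF assms(1) z(2)] zero_product_iff[OF assms(2) z(2)] z(1) c c_in
      by (simp add: ann_def)
  qed
  then show ?thesis by (auto simp: ann_def)
qed

lemma zero_divisor_imp:
  assumes "T x a" "a \<in> carrier S" "x \<in> zero_divisors R"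
  shows "a \<in> zero_divisors S"
proof -
  obtain y where x: "x \<in> carrier R" and y: "y \<in> carrier R" "y \<noteq> \<zero>\<^bsub>R\<^esub>" "x \<otimes>\<^bsub>R\<^esub> y = \<zero>\<^bsub>R\<^esub>"
    using assms(3) by (auto simp: zero_divisors_def)
  obtain b where b: "b \<in> carrier S" "T y b" using left_total y by blast
  interpret conv: zero_product_correspondence S R "T\<inverse>\<inverse>" by (rule converse)
  have "b \<noteq> \<zero>\<^bsub>S\<^esub>" using conv.zero_imp[of b y] b y by auto
  moreover have "a \<otimes>\<^bsub>S\<^esub> b = \<zero>\<^bsub>S\<^esub>" using zero_product_iff[OF assms(1) b(2)] x y b assms(2) by simp
  ultimately show ?thesis using assms b by (auto simp: zero_divisors_def)
qed

end

section \<open>Vertices and arcs in terms of representatives\<close>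

lemma ann_class_eq_iff:
  assumes "x \<in> carrier R"
  shows "ann_class R x = ann_class R y \<longleftrightarrow> ann R x = ann R y"
  using assms by (auto simp: ann_class_def)

lemma pverts_compressed_zero_divisor_graph:
  "pverts (\<Gamma>\<^sub>C R) = ann_class R ` (zero_divisors R - {\<zero>\<^bsub>R\<^esub>})"
  by (auto simp: compressed_zero_divisor_graph_def)

lemma (in cring) ann_class_in_parcs_iff:
  assumes "x \<in> zero_divisors R - {\<zero>}" "y \<in> zero_divisors R - {\<zero>}"
  shows "(ann_class R x, ann_class R y) \<in> parcs (\<Gamma>\<^sub>C R) \<longleftrightarrow>
    ann_class R x \<noteq> ann_class R y \<and> x \<otimes> y = \<zero>"
proof -
  have "x \<in> carrier R" "y \<in> carrier R" using assms by (auto simp: zero_divisors_def)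
  note iff = ann_class_mult_zero_iff[OF cring_axioms this]
  show ?thesis
    using assms by (auto simp: compressed_zero_divisor_graph_def iff)
qed

context zero_product_correspondence
begin

text \<open>The class of \<open>x\<close> is sent to the class of any partner of \<open>x\<close>.
  Partners preserve and reflect equality of annihilators, which makes this well defined and
  injective; right totality makes it onto.\<close>

lemma digraph_iso_compressed_zero_divisor_graph:
  "digraph_iso (with_proj (\<Gamma>\<^sub>C R)) (with_proj (\<Gamma>\<^sub>C S))"
proof -
  interpret conv: zero_product_correspondence S R "T\<inverse>\<inverse>" by (rule converse)
  let ?V = "zero_divisors R - {\<zero>\<^bsub>R\<^esub>}" and ?W = "zero_divisors S - {\<zero>\<^bsub>S\<^esub>}"
  have V: "x \<in> carrier R" if "x \<in> ?V" for x using that by (simp add: zero_divisors_def)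
  have W: "a \<in> carrier S" if "a \<in> ?W" for a using that by (simp add: zero_divisors_def)
  obtain g where g: "\<And>x. x \<in> carrier R \<Longrightarrow> g x \<in> carrier S \<and> T x (g x)"
    using left_total by metis
  have class_iff: "ann_class R x = ann_class R y \<longleftrightarrow> ann_class S a = ann_class S b"
    if *: "T x a" "T y b" "x \<in> carrier R" "y \<in> carrier R" "a \<in> carrier S" "b \<in> carrier S"
    for x y a b
  proof -
    have "ann S a = ann S b" if "ann R x = ann R y" using ann_eq_imp[OF *(1,2)] *(3-6) that by blast
    moreover have "ann R x = ann R y" if "ann S a = ann S b"
      by (rule conv.ann_eq_imp[of a x b y, unfolded conversep_iff, OF *(1,2,5,6,3,4) that])
    ultimately show ?thesis
      unfolding ann_class_eq_iff[OF *(3)] ann_class_eq_iff[OF *(5)] by blast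
  qed
  have vertex: "a \<in> ?W" if "T x a" "x \<in> ?V" "a \<in> carrier S" for x a
    using zero_divisor_imp[OF that(1,3)] conv.zero_imp[of a x] V[OF that(2)] that
    by (simp only: conversep_iff Diff_iff singleton_iff) blast
  have vertex': "x \<in> ?V" if "T x a" "a \<in> ?W" "x \<in> carrier R" for x a
    using conv.zero_divisor_imp[of a x] zero_imp[OF that(1,3)] W[OF that(2)] that
    by (simp only: conversep_iff Diff_iff singleton_iff) blast
  \<comment> \<open>The map must be defined on classes, so a representative is chosen; the next fact
    shows that the choice does not matter.\<close>
  define f where "f U = ann_class S (g (SOME x. x \<in> U))" for U
  have f: "f (ann_class R x) = ann_class S (g x)" if "x \<in> carrier R" for x
  proof -
    define y where "y = (SOME y. y \<in> ann_class R x)"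
    have "y \<in> ann_class R x"
      unfolding y_def by (rule someI[of _ x]) (simp add: ann_class_def that)
    then have "y \<in> carrier R" "ann_class R y = ann_class R x" by (auto simp: ann_class_def)
    then show ?thesis
      unfolding f_def y_def[symmetric] using class_iff[of y "g y" x "g x"] g that by simp
  qed
  have "bij_betw f (ann_class R ` ?V) (ann_class S ` ?W)"
  proof (rule bij_betw_imageI)
    show "inj_on f (ann_class R ` ?V)"
    proof (rule inj_onI, elim imageE, hypsubst)
      fix x y assume "x \<in> ?V" "y \<in> ?V" "f (ann_class R x) = f (ann_class R y)"
      then show "ann_class R x = ann_class R y"
        using class_iff[of x "g x" y "g y"] g V f by metis
    qed
    show "f ` ann_class R ` ?V = ann_class S ` ?W"
    proof
      show "f ` ann_class R ` ?V \<subseteq> ann_class S ` ?W"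
      proof (intro subsetI, elim imageE, hypsubst)
        fix x assume x: "x \<in> ?V"
        then have "g x \<in> ?W" using vertex[of x "g x"] g[OF V[OF x]] by blast
        then show "f (ann_class R x) \<in> ann_class S ` ?W" unfolding f[OF V[OF x]] by (rule imageI)
      qed
      show "ann_class S ` ?W \<subseteq> f ` ann_class R ` ?V"
      proof
        fix U assume "U \<in> ann_class S ` ?W"
        then obtain a where a: "a \<in> ?W" "U = ann_class S a" by blast
        obtain x where x: "x \<in> carrier R" "T x a" using right_total W[OF a(1)] by blast
        \<comment> \<open>Here \<open>g x\<close> may differ from \<open>a\<close>, but both are
          partners of \<open>x\<close> and hence lie in the same class.\<close>
        have "f (ann_class R x) = U"
          using class_iff[of x a x "g x"] x g W[OF a(1)] a by (simp add: f)
        then show "U \<in> f ` ann_class R ` ?V" using vertex'[OF x(2) a(1) x(1)] by blast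
      qed
    qed
  qed
  moreover have "(ann_class R x, ann_class R y) \<in> parcs (\<Gamma>\<^sub>C R) \<longleftrightarrow>
      (f (ann_class R x), f (ann_class R y)) \<in> parcs (\<Gamma>\<^sub>C S)"
    if "x \<in> ?V" "y \<in> ?V" for x y
  proof -
    note x = V[OF that(1)] and y = V[OF that(2)]
    have T: "T x (g x)" "T y (g y)" and c: "g x \<in> carrier S" "g y \<in> carrier S"
      using g[OF x] g[OF y] by blast+
    have gxy: "g x \<in> ?W" "g y \<in> ?W" using vertex T c that by blast+
    show ?thesis
      unfolding f[OF x] f[OF y] R.ann_class_in_parcs_iff[OF that] S.ann_class_in_parcs_iff[OF gxy]
        class_iff[OF T x y c] zero_product_iff[OF T x y c] ..
  qed
  moreover have "pair_wf_digraph (\<Gamma>\<^sub>C R)" "pair_wf_digraph (\<Gamma>\<^sub>C S)"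
    using compressed_zero_divisor_graph_simple[OF R.cring_axioms]
      compressed_zero_divisor_graph_simple[OF S.cring_axioms]
    by (simp_all add: pair_bidirected_digraph_def pair_sym_digraph_def)
  ultimately show ?thesis
    by (auto simp: digraph_iso_pair_iff pverts_compressed_zero_divisor_graph intro!: exI[of _ f])
qed

end

section \<open>Passage to quotient rings\<close>

lemma (in ideal) quotient_coset_mult_zero_iff:
  assumes "x \<in> carrier R" "y \<in> carrier R"
  shows "(I +> x) \<otimes>\<^bsub>R Quot I\<^esub> (I +> y) = \<zero>\<^bsub>R Quot I\<^esub> \<longleftrightarrow> x \<otimes> y \<in> I"
  using assms a_rcos_const[of "x \<otimes> y"] a_rcos_self[of "x \<otimes> y"]
  by (auto simp: FactRing_def rcoset_mult_add)

text \<open>Cosets are related as soon as some of their representatives are. Whether a product of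
  cosets vanishes can be tested on any representatives, in particular on those that the relation
  supplies.\<close>

lemma zero_product_correspondence_quotient:
  assumes "ideal I R" "ideal J S" "cring R" "cring S"
    and left: "\<And>x. x \<in> carrier R \<Longrightarrow> \<exists>a \<in> carrier S. T x a"
    and right: "\<And>a. a \<in> carrier S \<Longrightarrow> \<exists>x \<in> carrier R. T x a"
    and prod: "\<And>x y a b. \<lbrakk>T x a; T y b; x \<in> carrier R; y \<in> carrier R; a \<in> carrier S; b \<in> carrier S\<rbrakk>
        \<Longrightarrow> x \<otimes>\<^bsub>R\<^esub> y \<in> I \<longleftrightarrow> a \<otimes>\<^bsub>S\<^esub> b \<in> J"
  shows "zero_product_correspondence (R Quot I) (S Quot J)
    (\<lambda>X Y. \<exists>x \<in> carrier R. \<exists>a \<in> carrier S. X = I +>\<^bsub>R\<^esub> x \<and> Y = J +>\<^bsub>S\<^esub> a \<and> T x a)"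
proof -
  interpret I: ideal I R by fact
  interpret J: ideal J S by fact
  interpret QR: cring "R Quot I" by (rule I.quotient_is_cring) fact
  interpret QS: cring "S Quot J" by (rule J.quotient_is_cring) fact
  have carriers: "carrier (R Quot I) = (+>\<^bsub>R\<^esub>) I ` carrier R"
    "carrier (S Quot J) = (+>\<^bsub>S\<^esub>) J ` carrier S"
    by (auto simp: FactRing_simps)
  show ?thesis
  proof unfold_locales
    fix X Y U V
    assume "\<exists>x \<in> carrier R. \<exists>a \<in> carrier S. X = I +>\<^bsub>R\<^esub> x \<and> U = J +>\<^bsub>S\<^esub> a \<and> T x a"
      and "\<exists>x \<in> carrier R. \<exists>a \<in> carrier S. Y = I +>\<^bsub>R\<^esub> x \<and> V = J +>\<^bsub>S\<^esub> a \<and> T x a"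
    then show "X \<otimes>\<^bsub>R Quot I\<^esub> Y = \<zero>\<^bsub>R Quot I\<^esub> \<longleftrightarrow> U \<otimes>\<^bsub>S Quot J\<^esub> V = \<zero>\<^bsub>S Quot J\<^esub>"
      using prod by (elim bexE conjE)
        (simp only: I.quotient_coset_mult_zero_iff J.quotient_coset_mult_zero_iff)
  qed (use left right in \<open>auto simp: carriers\<close>, blast+)
qed

section \<open>Divisibility by prime powers\<close>

context domain
begin

lemma ring_primeD:
  assumes "ring_prime p" "p \<in> carrier R" "a \<in> carrier R" "b \<in> carrier R" "p divides a \<otimes> b"
  shows "p divides a \<or> p divides b"
  using assms by (auto simp: ring_prime_def prime_def)

lemma ring_prime_not_divides_one:
  assumes "ring_prime p" "p \<in> carrier R"
  shows "\<not> p divides \<one>"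
  using assms(1) unfolding divides_one[OF assms(2)] by (auto simp only: ring_prime_def prime_def)

lemma pow_divides_pow:
  assumes "p \<in> carrier R" "i \<le> (j::nat)"
  shows "p [^] i divides p [^] j"
  using assms nat_pow_mult[of p i "j - i"] by (intro dividesI[of "p [^] (j - i)"]) auto

lemma nat_pow_nonzero:
  assumes "p \<in> carrier R" "p \<noteq> \<zero>"
  shows "p [^] (n::nat) \<noteq> \<zero>"
  using assms by (induction n) (auto simp: integral_iff)

text \<open>Additivity of the \<open>p\<close>-adic valuation, phrased by divisibility so that
  elements of infinite valuation, such as zero, are covered. Both exponents on the right are at most
  \<open>m\<close>, so only powers up to \<open>p [^] m\<close> are consulted.\<close>

lemma prime_power_divides_mult_iff:
  assumes p: "ring_prime p" "p \<in> carrier R" and xy: "x \<in> carrier R" "y \<in> carrier R"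
  shows "p [^] (m::nat) divides x \<otimes> y \<longleftrightarrow>
    (\<exists>j\<le>m. p [^] j divides x \<and> p [^] (m - j) divides y)"
proof
  assume "\<exists>j\<le>m. p [^] j divides x \<and> p [^] (m - j) divides y"
  then obtain j u v where j: "j \<le> m" and uv: "u \<in> carrier R" "v \<in> carrier R"
    and xy': "x = p [^] j \<otimes> u" "y = p [^] (m - j) \<otimes> v"
    by (auto simp: factor_def)
  have "x \<otimes> y = (p [^] j \<otimes> p [^] (m - j)) \<otimes> (u \<otimes> v)"
    unfolding xy' using p uv by (simp add: m_ac)
  also have "p [^] j \<otimes> p [^] (m - j) = p [^] m" using p j by (simp add: nat_pow_mult)
  finally show "p [^] m divides x \<otimes> y" using uv by (auto simp: factor_def)
next
  assume "p [^] m divides x \<otimes> y"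
  then show "\<exists>j\<le>m. p [^] j divides x \<and> p [^] (m - j) divides y"
  proof (induction m)
    case 0
    then show ?case using xy by (simp add: one_divides)
  next
    case (Suc m)
    have "p [^] m divides p [^] Suc m" using p by (intro pow_divides_pow) auto
    then have "p [^] m divides x \<otimes> y" using Suc.prems p xy by (meson divides_trans nat_pow_closed)
    then obtain j u v where j: "j \<le> m" and uv: "u \<in> carrier R" "v \<in> carrier R"
      and xy': "x = p [^] j \<otimes> u" "y = p [^] (m - j) \<otimes> v"
      using Suc.IH by (auto simp: factor_def)
    have "x \<otimes> y = (p [^] j \<otimes> p [^] (m - j)) \<otimes> (u \<otimes> v)"
      unfolding xy' using p uv by (simp add: m_ac)
    also have "p [^] j \<otimes> p [^] (m - j) = p [^] m" using p j by (simp add: nat_pow_mult)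
    finally have "p [^] m \<otimes> p divides p [^] m \<otimes> (u \<otimes> v)" using Suc.prems by simp
    moreover have "p [^] m \<noteq> \<zero>" using p by (auto simp: ring_prime_def nat_pow_nonzero)
    \<comment> \<open>Cancelling \<open>p [^] m\<close> leaves one factor \<open>p\<close> in the
      product of the cofactors. By primality it goes to \<open>u\<close>, which raises
      \<open>j\<close> by one, or to \<open>v\<close>, which keeps \<open>j\<close>.\<close>
    ultimately have "p divides u \<otimes> v"
      using mult_divides[of p "u \<otimes> v" "p [^] m"] p(2) uv by simp
    then consider "p divides u" | "p divides v" using ring_primeD p uv by blast
    then show ?case
    proof cases
      case 1
      then have "p [^] Suc j divides x" using p uv by (simp add: xy' divides_mult)
      moreover have "p [^] (Suc m - Suc j) divides y" using p uv by (auto simp: xy' factor_def)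
      ultimately show ?thesis using j by (intro exI[of _ "Suc j"]) auto
    next
      case 2
      then have "p [^] Suc (m - j) divides y" using p uv by (simp add: xy' divides_mult)
      moreover have "p [^] j divides x" using p uv by (auto simp: xy' factor_def)
      ultimately show ?thesis using j by (intro exI[of _ j]) (auto simp: Suc_diff_le)
    qed
  qed
qed

text \<open>In a splitting of the exponent \<open>m\<close> between \<open>x\<close> and
  \<open>y\<close>, a positive share for \<open>x\<close> would make \<open>p\<close> divide
  \<open>x\<close>.\<close>

lemma prime_power_divides_mult_coprime:
  assumes p: "ring_prime p" "p \<in> carrier R" and xy: "x \<in> carrier R" "y \<in> carrier R"
    and x: "\<not> p divides x" and d: "p [^] (m::nat) divides x \<otimes> y"
  shows "p [^] m divides y"
proof -
  obtain j where j: "j \<le> m" "p [^] j divides x" "p [^] (m - j) divides y"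
    using d prime_power_divides_mult_iff[OF p xy] by blast
  have "j = 0"
  proof (rule ccontr)
    assume "j \<noteq> 0"
    then have "p divides p [^] j" using pow_divides_pow[of p 1 j] p by simp
    then show False using x j(2) p xy by (meson divides_trans nat_pow_closed)
  qed
  then show ?thesis using j by simp
qed

text \<open>The valuation of \<open>p [^] e \<otimes> u\<close> is exactly \<open>e\<close>: a
  higher power of \<open>p\<close> would, after cancelling \<open>p [^] e\<close>, leave a factor
  \<open>p\<close> in \<open>u\<close>.\<close>

lemma prime_power_divides_pow_mult_iff:
  assumes p: "ring_prime p" "p \<in> carrier R" and u: "u \<in> carrier R" "\<not> p divides u"
  shows "p [^] (m::nat) divides p [^] (e::nat) \<otimes> u \<longleftrightarrow> m \<le> e"
proof
  assume "m \<le> e"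
  then have "p [^] m divides p [^] e" using p by (intro pow_divides_pow)
  then show "p [^] m divides p [^] e \<otimes> u" using p u by (intro divides_prod_r) auto
next
  assume d: "p [^] m divides p [^] e \<otimes> u"
  show "m \<le> e"
  proof (rule ccontr)
    assume "\<not> m \<le> e"
    then have "p [^] (e + 1) divides p [^] m" using p by (intro pow_divides_pow) auto
    then have "p [^] e \<otimes> p divides p [^] e \<otimes> u" using d p u
      by (simp, meson divides_trans m_closed nat_pow_closed)
    moreover have "p [^] e \<noteq> \<zero>" using p by (auto simp: ring_prime_def nat_pow_nonzero)
    ultimately have "p divides u"
      using mult_divides[of p u "p [^] e"] p(2) u(1) by simp
    then show False using u by simp
  qed
qed

lemma prime_not_divides_finprod_powers:
  assumes "finite J" "ring_prime p" "p \<in> carrier R" "\<And>i. i \<in> J \<Longrightarrow> q i \<in> carrier R"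
    "\<And>i. i \<in> J \<Longrightarrow> \<not> p divides q i"
  shows "\<not> p divides (\<Otimes>i\<in>J. q i [^] (e i :: nat))"
  using assms
proof (induction J)
  case empty
  then show ?case
    using ring_prime_not_divides_one[OF empty.prems(1,2)] by (simp only: finprod_empty not_False_eq_True)
next
  case (insert i J)
  have pow: "\<not> p divides q i [^] (k::nat)" for k
  proof (induction k)
    case 0
    then show ?case using insert.prems(1,2) by (simp add: ring_prime_not_divides_one)
  next
    case (Suc k)
    then show ?case using ring_primeD[of p "q i [^] k" "q i"] insert.prems by auto
  qed
  have P: "(\<lambda>j. q j [^] e j) \<in> J \<rightarrow> carrier R" using insert.prems by auto
  have "(\<Otimes>j\<in>insert i J. q j [^] e j) = q i [^] e i \<otimes> (\<Otimes>j\<in>J. q j [^] e j)"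
    using insert.hyps insert.prems P by simp
  then show ?case
    using ring_primeD[of p "q i [^] e i" "\<Otimes>j\<in>J. q j [^] e j"] pow[of "e i"] insert P by auto
qed

text \<open>Powers of distinct primes are coprime. In the induction,
  \<open>z = ?P \<otimes> u\<close> with \<open>?P\<close> the product over the smaller set; since
  \<open>p i\<close> does not divide \<open>?P\<close>, its power must divide
  \<open>u\<close>.\<close>

lemma finprod_prime_powers_divides_iff:
  assumes "finite J" "z \<in> carrier R"
    "\<And>i. i \<in> J \<Longrightarrow> p i \<in> carrier R" "\<And>i. i \<in> J \<Longrightarrow> ring_prime (p i)"
    "\<And>i j. \<lbrakk>i \<in> J; j \<in> J; i \<noteq> j\<rbrakk> \<Longrightarrow> \<not> p i divides p j"
  shows "(\<Otimes>i\<in>J. p i [^] (s i :: nat)) divides z \<longleftrightarrow> (\<forall>i\<in>J. p i [^] s i divides z)"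
  using assms
proof (induction J)
  case empty
  then show ?case by (simp add: one_divides)
next
  case (insert i J)
  let ?P = "\<Otimes>j\<in>J. p j [^] s j"
  have F: "(\<lambda>j. p j [^] s j) \<in> J \<rightarrow> carrier R" using insert.prems by auto
  have P: "?P \<in> carrier R" using F by simp
  have IH: "?P divides z \<longleftrightarrow> (\<forall>i\<in>J. p i [^] s i divides z)"
    by (rule insert.IH) (use insert.prems in auto)
  have pi: "p i \<in> carrier R" "ring_prime (p i)" using insert.prems by auto
  have nd: "\<not> p i divides ?P"
    using insert.hyps insert.prems by (intro prime_not_divides_finprod_powers) blast+
  have prod: "(\<Otimes>j\<in>insert i J. p j [^] s j) = p i [^] s i \<otimes> ?P"
    using insert.hyps pi F by simp
  have "p i [^] s i \<otimes> ?P divides z \<longleftrightarrow> p i [^] s i divides z \<and> ?P divides z"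
  proof
    assume d: "p i [^] s i \<otimes> ?P divides z"
    have "p i [^] s i divides p i [^] s i \<otimes> ?P" "?P divides p i [^] s i \<otimes> ?P"
      using pi P by (auto intro: divides_prod_r divides_prod_l)
    then show "p i [^] s i divides z \<and> ?P divides z"
      using d pi P insert.prems(1) by (meson divides_trans nat_pow_closed m_closed)
  next
    assume "p i [^] s i divides z \<and> ?P divides z"
    then obtain u where u: "u \<in> carrier R" "z = ?P \<otimes> u" and d: "p i [^] s i divides ?P \<otimes> u"
      by blast
    have "p i [^] s i divides u"
      using prime_power_divides_mult_coprime[OF pi(2,1) P u(1) nd d] .
    then have "?P \<otimes> p i [^] s i divides ?P \<otimes> u" using pi P by (intro divides_mult) auto
    then show "p i [^] s i \<otimes> ?P divides z" using u pi P by (simp add: m_comm)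
  qed
  then show ?case using IH prod by simp
qed

text \<open>Splitting off the factor with index \<open>i\<close> leaves a product not divisible by
  \<open>p i\<close>. Thus products of prime powers realise prescribed valuations.\<close>

lemma prime_power_divides_finprod_iff:
  assumes "finite J" "i \<in> J"
    and p: "\<And>i. i \<in> J \<Longrightarrow> p i \<in> carrier R" "\<And>i. i \<in> J \<Longrightarrow> ring_prime (p i)"
    "\<And>i j. \<lbrakk>i \<in> J; j \<in> J; i \<noteq> j\<rbrakk> \<Longrightarrow> \<not> p i divides p j"
  shows "p i [^] m divides (\<Otimes>j\<in>J. p j [^] (e j :: nat)) \<longleftrightarrow> m \<le> e i"
proof -
  let ?P = "\<Otimes>j\<in>J - {i}. p j [^] e j"
  have F: "(\<lambda>j. p j [^] e j) \<in> J - {i} \<rightarrow> carrier R" using p by auto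
  have "(\<Otimes>j\<in>insert i (J - {i}). p j [^] e j) = p i [^] e i \<otimes> ?P"
    using assms F by (intro finprod_insert) auto
  moreover have "\<not> p i divides ?P"
    using assms by (intro prime_not_divides_finprod_powers) auto
  ultimately show ?thesis
    using prime_power_divides_pow_mult_iff[of "p i" ?P m "e i"] assms F
    by (simp add: insert_absorb)
qed

text \<open>A proper divisor of the irreducible \<open>q\<close> is a unit, which the irreducible
  \<open>p\<close> is not. This turns pairwise non-associated into pairwise non-dividing.\<close>

lemma associated_if_divides_ring_irreducible:
  assumes "ring_irreducible p" "ring_irreducible q" "p \<in> carrier R" "q \<in> carrier R" "p divides q"
  shows "p \<sim> q"
  using assms by (auto simp: ring_irreducible_def irreducible_def properfactor_def associated_def)

end

text \<open>Unique factorization is a property of the monoid \<open>mult_of R\<close> of nonzero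
  elements; irreducibility is moved there and primality is moved back.\<close>

lemma (in factorial_domain) ring_irreducible_imp_ring_prime:
  assumes "ring_irreducible p" "p \<in> carrier R"
  shows "ring_prime p"
proof -
  have "irreducible (mult_of R) p" "p \<noteq> \<zero>" using assms ring_irreducibleE by auto
  then have "prime (mult_of R) p" using assms by (intro irreducible_prime) auto
  then show ?thesis using assms \<open>p \<noteq> \<zero>\<close> prime_eq_prime_mult by (simp add: ring_prime_def)
qed

section \<open>The correspondence between two factorial domains\<close>

text \<open>For primes in domains: the valuation of \<open>x\<close> at \<open>p i\<close> and that
  of \<open>a\<close> at \<open>q i\<close> agree after truncation at \<open>s i\<close>. Truncation
  keeps them finite even at zero.\<close>

definition same_prime_powers ::
    "('a, 'm) ring_scheme \<Rightarrow> ('b, 'k) ring_scheme \<Rightarrow> 'i set \<Rightarrow> ('i \<Rightarrow> 'a) \<Rightarrow> ('i \<Rightarrow> 'b) \<Rightarrow> ('i \<Rightarrow> nat)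
      \<Rightarrow> 'a \<Rightarrow> 'b \<Rightarrow> bool" where
  "same_prime_powers R S J p q s x a \<longleftrightarrow>
    (\<forall>i \<in> J. \<forall>j \<le> s i. p i [^]\<^bsub>R\<^esub> j divides\<^bsub>R\<^esub> x \<longleftrightarrow> q i [^]\<^bsub>S\<^esub> j divides\<^bsub>S\<^esub> a)"

lemma same_prime_powers_commute:
  "same_prime_powers R S J p q s x a \<longleftrightarrow> same_prime_powers S R J q p s a x"
  by (auto simp: same_prime_powers_def)

text \<open>The partner is the product of the \<open>q i\<close> raised to the truncated valuations
  of \<open>x\<close> at the \<open>p i\<close>.\<close>

lemma same_prime_powers_left_total:
  assumes "domain R" "domain S" "finite J" and x: "x \<in> carrier R"
    and p: "\<And>i. i \<in> J \<Longrightarrow> p i \<in> carrier R"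
    and q: "\<And>i. i \<in> J \<Longrightarrow> q i \<in> carrier S" "\<And>i. i \<in> J \<Longrightarrow> ring_prime\<^bsub>S\<^esub> (q i)"
      "\<And>i j. \<lbrakk>i \<in> J; j \<in> J; i \<noteq> j\<rbrakk> \<Longrightarrow> \<not> q i divides\<^bsub>S\<^esub> q j"
  shows "\<exists>a \<in> carrier S. same_prime_powers R S J p q s x a"
proof -
  interpret R: domain R by fact
  interpret S: domain S by fact
  define E where "E i = {j. j \<le> s i \<and> p i [^]\<^bsub>R\<^esub> j divides\<^bsub>R\<^esub> x}" for i
  \<comment> \<open>The maximum exists since \<open>E i\<close> is bounded by \<open>s i\<close>,
    even for \<open>x\<close> zero, and contains 0 because one divides \<open>x\<close>.\<close>
  define e where "e i = Max (E i)" for i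
  have fin: "finite (E i)" for i by (simp add: E_def)
  have e: "e i \<in> E i" for i
  proof -
    have "0 \<in> E i" using x by (simp add: E_def R.one_divides)
    then show ?thesis unfolding e_def using fin Max_in by blast
  qed
  have p_iff: "p i [^]\<^bsub>R\<^esub> j divides\<^bsub>R\<^esub> x \<longleftrightarrow> j \<le> e i" if "i \<in> J" "j \<le> s i" for i j
  proof
    assume "p i [^]\<^bsub>R\<^esub> j divides\<^bsub>R\<^esub> x"
    then show "j \<le> e i" unfolding e_def using that fin by (intro Max_ge) (auto simp: E_def)
  next
    assume "j \<le> e i"
    then have "p i [^]\<^bsub>R\<^esub> j divides\<^bsub>R\<^esub> p i [^]\<^bsub>R\<^esub> e i" using p that by (intro R.pow_divides_pow) auto
    then show "p i [^]\<^bsub>R\<^esub> j divides\<^bsub>R\<^esub> x"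
      using e[of i] x p that by (auto simp: E_def intro: R.divides_trans)
  qed
  let ?a = "\<Otimes>\<^bsub>S\<^esub>j\<in>J. q j [^]\<^bsub>S\<^esub> e j"
  have "q i [^]\<^bsub>S\<^esub> j divides\<^bsub>S\<^esub> ?a \<longleftrightarrow> j \<le> e i" if "i \<in> J" for i j
    using that assms by (intro S.prime_power_divides_finprod_iff) auto
  then have "same_prime_powers R S J p q s x ?a" by (simp add: same_prime_powers_def p_iff)
  moreover have "?a \<in> carrier S" using q by auto
  ultimately show ?thesis by blast
qed

text \<open>Divisibility of a product by the \<open>s i\<close>-th power depends on exponents
  \<open>j\<close> and \<open>s i - j\<close> of the factors, all within the truncation
  bound.\<close>

lemma same_prime_powers_mult:
  assumes "domain R" "domain S"
    and "same_prime_powers R S J p q s x a" "same_prime_powers R S J p q s y b"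
    and "x \<in> carrier R" "y \<in> carrier R" "a \<in> carrier S" "b \<in> carrier S" and "i \<in> J"
    and "p i \<in> carrier R" "ring_prime\<^bsub>R\<^esub> (p i)" "q i \<in> carrier S" "ring_prime\<^bsub>S\<^esub> (q i)"
  shows "p i [^]\<^bsub>R\<^esub> s i divides\<^bsub>R\<^esub> x \<otimes>\<^bsub>R\<^esub> y \<longleftrightarrow> q i [^]\<^bsub>S\<^esub> s i divides\<^bsub>S\<^esub> a \<otimes>\<^bsub>S\<^esub> b"
  using assms
  by (auto simp: domain.prime_power_divides_mult_iff same_prime_powers_def)

section \<open>Principal ideals and prime power factorizations\<close>

lemma (in cring) mem_cgenideal_iff_divides:
  assumes "n \<in> carrier R"
  shows "x \<in> PIdl n \<longleftrightarrow> n divides x"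
  using assms m_comm[of n] by (auto simp: cgenideal_def factor_def)

text \<open>Restates the factorization with primes that do not divide one another, the form that the
  divisibility lemmas use.\<close>

lemma (in factorial_domain) irreducible_power_factorizationD:
  assumes "irreducible_power_factorization R n k p s"
  shows "\<And>i. i \<in> {1..k} \<Longrightarrow> p i \<in> carrier R"
    and "\<And>i. i \<in> {1..k} \<Longrightarrow> ring_prime (p i)"
    and "\<And>i j. \<lbrakk>i \<in> {1..k}; j \<in> {1..k}; i \<noteq> j\<rbrakk> \<Longrightarrow> \<not> p i divides p j"
    and "n = (\<Otimes>i\<in>{1..k}. p i [^] s i)"
proof -
  note f = assms[unfolded irreducible_power_factorization_def]
  show "p i \<in> carrier R" if "i \<in> {1..k}" for i using f that by blast
  show "ring_prime (p i)" if "i \<in> {1..k}" for i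
    using f that ring_irreducible_imp_ring_prime by blast
  show "\<not> p i divides p j" if "i \<in> {1..k}" "j \<in> {1..k}" "i \<noteq> j" for i j
    using f that associated_if_divides_ring_irreducible by blast
  show "n = (\<Otimes>i\<in>{1..k}. p i [^] s i)" using f by blast
qed

lemma (in factorial_domain) mem_cgenideal_iff_prime_powers:
  assumes "irreducible_power_factorization R n k p s" "x \<in> carrier R"
  shows "x \<in> PIdl n \<longleftrightarrow> (\<forall>i\<in>{1..k}. p i [^] s i divides x)"
proof -
  note f = irreducible_power_factorizationD[OF assms(1)]
  have "n \<in> carrier R" unfolding f(4) using f(1) by (intro finprod_closed) auto
  then show ?thesis
    using finprod_prime_powers_divides_iff[of "{1..k}" x p s] f assms(2)
    by (simp add: mem_cgenideal_iff_divides)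
qed

theorem theorem8:
  fixes D\<^sub>1 :: "('a, 'm) ring_scheme" and D\<^sub>2 :: "('b, 'k) ring_scheme"
    and n\<^sub>1 :: 'a and n\<^sub>2 :: 'b
    and A B :: nat and p :: "nat \<Rightarrow> 'a" and q :: "nat \<Rightarrow> 'b" and s t :: "nat \<Rightarrow> nat"
  assumes "factorial_domain D\<^sub>1" and "factorial_domain D\<^sub>2"
    and "n\<^sub>1 \<in> carrier D\<^sub>1" and "n\<^sub>1 \<noteq> \<zero>\<^bsub>D\<^sub>1\<^esub>" and "n\<^sub>1 \<notin> Units D\<^sub>1"
    and "n\<^sub>2 \<in> carrier D\<^sub>2" and "n\<^sub>2 \<noteq> \<zero>\<^bsub>D\<^sub>2\<^esub>" and "n\<^sub>2 \<notin> Units D\<^sub>2"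
    and "irreducible_power_factorization D\<^sub>1 n\<^sub>1 A p s"
    and "irreducible_power_factorization D\<^sub>2 n\<^sub>2 B q t"
    and "A = B" and "\<forall>i \<in> {1..A}. s i = t i"
  shows "digraph_iso (with_proj (\<Gamma>\<^sub>C (D\<^sub>1 Quot (PIdl\<^bsub>D\<^sub>1\<^esub> n\<^sub>1))))
                     (with_proj (\<Gamma>\<^sub>C (D\<^sub>2 Quot (PIdl\<^bsub>D\<^sub>2\<^esub> n\<^sub>2))))"
proof -
  interpret R: factorial_domain D\<^sub>1 by fact
  interpret S: factorial_domain D\<^sub>2 by fact
  let ?I = "PIdl\<^bsub>D\<^sub>1\<^esub> n\<^sub>1" and ?J = "PIdl\<^bsub>D\<^sub>2\<^esub> n\<^sub>2"
  let ?T = "same_prime_powers D\<^sub>1 D\<^sub>2 {1..A} p q s"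
  \<comment> \<open>Since \<open>s\<close> and \<open>t\<close> agree on \<open>{1..A}\<close>, the
    exponents \<open>s\<close> serve both factorizations, so a single truncation bound enters
    \<open>?T\<close>.\<close>
  have "irreducible_power_factorization D\<^sub>2 n\<^sub>2 A q s"
  proof -
    have "(\<Otimes>\<^bsub>D\<^sub>2\<^esub>i\<in>{1..A}. q i [^]\<^bsub>D\<^sub>2\<^esub> s i) = (\<Otimes>\<^bsub>D\<^sub>2\<^esub>i\<in>{1..A}. q i [^]\<^bsub>D\<^sub>2\<^esub> t i)"
      using assms by (intro S.finprod_cong') (auto simp: irreducible_power_factorization_def)
    then show ?thesis using assms by (auto simp: irreducible_power_factorization_def)
  qed
  note fac = assms(9) this
  note p = R.irreducible_power_factorizationD[OF fac(1)]
    and q = S.irreducible_power_factorizationD[OF fac(2)]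
  have prod: "x \<otimes>\<^bsub>D\<^sub>1\<^esub> y \<in> ?I \<longleftrightarrow> a \<otimes>\<^bsub>D\<^sub>2\<^esub> b \<in> ?J"
    if "?T x a" "?T y b" "x \<in> carrier D\<^sub>1" "y \<in> carrier D\<^sub>1" "a \<in> carrier D\<^sub>2" "b \<in> carrier D\<^sub>2"
    for x y a b
  proof -
    have "p i [^]\<^bsub>D\<^sub>1\<^esub> s i divides\<^bsub>D\<^sub>1\<^esub> x \<otimes>\<^bsub>D\<^sub>1\<^esub> y \<longleftrightarrow> q i [^]\<^bsub>D\<^sub>2\<^esub> s i divides\<^bsub>D\<^sub>2\<^esub> a \<otimes>\<^bsub>D\<^sub>2\<^esub> b"
      if "i \<in> {1..A}" for i
      using same_prime_powers_mult[OF R.domain_axioms S.domain_axioms \<open>?T x a\<close> \<open>?T y b\<close> _ _ _ _ that]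
        p(1,2)[OF that] q(1,2)[OF that] \<open>x \<in> _\<close> \<open>y \<in> _\<close> \<open>a \<in> _\<close> \<open>b \<in> _\<close> by blast
    then show ?thesis
      using that R.mem_cgenideal_iff_prime_powers[OF fac(1)]
        S.mem_cgenideal_iff_prime_powers[OF fac(2)] by simp
  qed
  have left: "\<exists>a \<in> carrier D\<^sub>2. ?T x a" if "x \<in> carrier D\<^sub>1" for x
    by (rule same_prime_powers_left_total[OF R.domain_axioms S.domain_axioms _ that p(1) q(1,2,3)])
      auto
  \<comment> \<open>The relation is symmetric in the two domains, so this is left totality with the
    roles exchanged.\<close>
  have right: "\<exists>x \<in> carrier D\<^sub>1. ?T x a" if "a \<in> carrier D\<^sub>2" for a
    unfolding same_prime_powers_commute[of D\<^sub>1]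
    by (rule same_prime_powers_left_total[OF S.domain_axioms R.domain_axioms _ that q(1) p(1,2,3)])
      auto
  have "ideal ?I D\<^sub>1" "ideal ?J D\<^sub>2"
    using assms by (simp_all add: R.cgenideal_ideal S.cgenideal_ideal)
  note corr = zero_product_correspondence_quotient[where T = ?T,
      OF this R.cring_axioms S.cring_axioms left right prod]
  show ?thesis
    by (rule zero_product_correspondence.digraph_iso_compressed_zero_divisor_graph[OF corr])
qed

end
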